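(* Let $F\subseteq[0,1]^2$ be a self-similar set which is not contained in a line. Then there exists $\theta\in[0,\pi)$ such that $$\dim_{\mathrm{A}}\pi_\theta F=1.$$
   Context: A self-similar set is the attractor of a finite collection (IFS) $\{S_i\}_{i\in\mathcal{I}}$ of contracting similarities of $\mathbb{R}^2$ mapping $[0,1]^2$ into itself, $S_i(x)=c_iO_i(x)+t_i$ with $c_i\in(0,1)$, $O_i\in O(2)$, $t_i\in\mathbb{R}^2$; that is, the unique non-empty compact set $F$ with $F=\bigcup_{i\in\mathcal{I}}S_i(F)$. No separation condition is assumed. For $\theta\in[0,\pi)$, $\pi_\theta$ denotes orthogonal projection of $\mathbb{R}^2$ onto the line through the origin forming angle $\theta$ with the positive $x$-axis. For a non-empty set $E$ and $r>0$, $N_r(E)$ is the smallest number of open sets of diameter at most $r$ needed to cover $E$. The Assouad dimension of a non-empty set $F\subseteq\mathbb{R}^d$ is $$\dim_{\mathrm{A}}F=\inf\Big\{s\ge 0:\ (\exists C>0)(\forall R>0)(\forall r\in(0,R))(\forall x\in F)\ N_r(B(x,R)\cap F)\le C\Big(\frac{R}{r}\Big)^s\Big\},$$ where $B(x,R)$ is the open Euclidean ball. *)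

theory Defs
  imports "HOL-Analysis.Analysis"
begin

definition unit_square :: "(real^2) set" where
  "unit_square = cbox 0 1"

definition contracting_similarity :: "(real^2 \<Rightarrow> real^2) \<Rightarrow> bool" where
  "contracting_similarity S \<longleftrightarrow>
     (\<exists>c Q t. 0 < c \<and> c < 1 \<and> orthogonal_matrix (Q :: real^2^2) \<and> (\<forall>x. S x = c *\<^sub>R (Q *v x) + t))"

definition is_IFS :: "'i set \<Rightarrow> ('i \<Rightarrow> real^2 \<Rightarrow> real^2) \<Rightarrow> bool" where
  "is_IFS I S \<longleftrightarrow>
     finite I \<and> (\<forall>i\<in>I. contracting_similarity (S i) \<and> S i ` unit_square \<subseteq> unit_square)"

definition is_attractor :: "'i set \<Rightarrow> ('i \<Rightarrow> real^2 \<Rightarrow> real^2) \<Rightarrow> (real^2) set \<Rightarrow> bool" where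
  "is_attractor I S F \<longleftrightarrow> compact F \<and> F \<noteq> {} \<and> F = (\<Union>i\<in>I. S i ` F)"

text \<open>Natural-number indices lose no generality since index sets are finite. The index set of an
  IFS with an attractor is non-empty because the attractor is.\<close>
definition self_similar_set :: "(real^2) set \<Rightarrow> bool" where
  "self_similar_set F \<longleftrightarrow> (\<exists>(I :: nat set) S. is_IFS I S \<and> is_attractor I S F)"

definition unit_dir :: "real \<Rightarrow> real^2" where
  "unit_dir \<theta> = vector [cos \<theta>, sin \<theta>]"

text \<open>The projection takes values in the line, viewed as a subset of the plane.\<close>
definition proj_line :: "real \<Rightarrow> real^2 \<Rightarrow> real^2" where
  "proj_line \<theta> x = (x \<bullet> unit_dir \<theta>) *\<^sub>R unit_dir \<theta>"

text \<open>Boundedness is required separately because \<^const>\<open>diameter\<close> is not meaningful for unbounded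
  sets. The value is infinite when there is no finite cover of the required kind.\<close>
definition covering_number :: "real \<Rightarrow> 'a::metric_space set \<Rightarrow> enat" where
  "covering_number r E =
     Inf {enat (card \<U>) | \<U>. finite \<U> \<and>
           (\<forall>U\<in>\<U>. open U \<and> bounded U \<and> diameter U \<le> r) \<and> E \<subseteq> \<Union>\<U>}"

definition assouad_dim :: "'a::euclidean_space set \<Rightarrow> ereal" where
  "assouad_dim F =
     Inf {ereal s | s. 0 \<le> s \<and>
           (\<exists>C>0. \<forall>R>0. \<forall>r\<in>{0<..<R}. \<forall>x\<in>F.
              ereal_of_enat (covering_number r (ball x R \<inter> F)) \<le> ereal (C * (R / r) powr s))}"

end

theory Submission
  imports Defs
begin

text \<open>
  A line has Assouad dimension at most one, so it suffices to find a direction in which the projection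
  of \<open>F\<close> contains, for every \<open>N\<close>, a chain of \<open>N + 1\<close> points whose consecutive gaps are all comparable,
  with a comparability constant independent of \<open>N\<close>. The scale of the chain is irrelevant: \<open>N + 1\<close> points that
  are \<open>\<delta>\<close>-separated within a ball of radius about \<open>N * \<delta>\<close> rule out every exponent below one
  (lemma \<open>assouad_dim_ge_1\<close>).

  Identify the plane with the complex numbers. Words in the maps of the IFS send \<open>F\<close> into arbitrarily
  small neighbourhoods of any of its points, and the square of a word preserves orientation. Taking such squares
  \<open>f1, f2, f3\<close> near three non-collinear points of \<open>F\<close>, the compositions
  \<open>f1 f2 f3\<close>, \<open>f2 f3 f1\<close>, \<open>f3 f1 f2\<close> have one common linear part \<open>a\<close> and non-collinear translations
  \<open>b0, b1, b2\<close> (lemma \<open>maps_with_common_linear_part\<close>). Hence \<open>F\<close> contains all finite expansions in powers of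
  \<open>a\<close> with digits \<open>b0, b1, b2\<close>, up to a common additive term. Switching the digits of one
  block of positions after the other produces a chain of points of \<open>F\<close>, and the task is to choose the blocks so that all switches move the projection
  by about the same amount (lemma \<open>digit_switching\<close>). There are two cases.

  If no power of \<open>a\<close> is a positive real, then the arguments of its powers are dense in the circle, by
  Kronecker's theorem, and every direction works. A switch changes a single digit, at a position with factor
  \<open>a ^ (K - n)\<close>. For fixed \<open>K\<close> this grows exponentially with \<open>n\<close>, but the projection compensates for that if the
  rotated digit difference is nearly perpendicular to the direction. Density allows the positions to be chosen
  one after the other, each with this property (lemma \<open>nested_directions\<close>).

  Otherwise one may replace \<open>a\<close> by a power and assume it to be a real number \<open>c\<close> in \<open>(0, 1)\<close>. Then the
  direction must be chosen. Let \<open>e1 = b1 - b0\<close> and \<open>e2 = b2 - b0\<close>, and project so that \<open>e2\<close> has \<open>\<lambda>\<close> times the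
  projection of \<open>e1\<close>, where \<open>\<lambda> = (\<Sum>i. c ^ (3 ^ i))\<close> is lacunary. A switch replaces a truncation of
  \<open>\<lambda> * e1\<close> by \<open>e2\<close>. The truncation to exponents below \<open>M = 3 ^ k\<close> has an error comparable to
  \<open>c ^ M\<close>; with \<open>e2\<close> at the position with factor \<open>c ^ (K - M)\<close>, the switch has size
  comparable to \<open>c ^ K\<close> for every \<open>k\<close>. The gaps in the exponents keep the blocks for different \<open>k\<close> disjoint (lemma \<open>rough_progressions_real_ratio\<close>).
\<close>

section \<open>Covering numbers and Assouad dimension\<close>

lemma covering_number_ge:
  fixes E :: "'a::metric_space set"
  assumes P: "finite P" "P \<subseteq> E" and sep: "\<And>x y. x \<in> P \<Longrightarrow> y \<in> P \<Longrightarrow> x \<noteq> y \<Longrightarrow> r < dist x y"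
  shows "enat (card P) \<le> covering_number r E"
  unfolding covering_number_def
proof (rule Inf_greatest, clarify)
  fix \<U> :: "'a set set"
  assume fin: "finite \<U>" and \<U>: "\<forall>U\<in>\<U>. open U \<and> bounded U \<and> diameter U \<le> r" and cov: "E \<subseteq> \<Union>\<U>"
  have "\<forall>x\<in>P. \<exists>U\<in>\<U>. x \<in> U" using cov P by blast
  then obtain f where f: "\<And>x. x \<in> P \<Longrightarrow> f x \<in> \<U> \<and> x \<in> f x" by metis
  have "inj_on f P"
  proof (rule inj_onI, rule ccontr)
    fix x y assume xy: "x \<in> P" "y \<in> P" "f x = f y" "x \<noteq> y"
    have "dist x y \<le> diameter (f x)"
      using f xy \<U> by (intro diameter_bounded_bound) auto
    also have "\<dots> \<le> r" using f xy \<U> by blast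
    finally show False using sep[OF xy(1,2,4)] by simp
  qed
  then have "card P \<le> card \<U>"
    using f fin by (intro card_inj_on_le) auto
  then show "enat (card P) \<le> enat (card \<U>)" by simp
qed

text \<open>
  Uniformly bi-Lipschitz copies of all the finite progressions \<open>0, 1, \<dots>, N\<close>, at arbitrary scales
  \<open>\<delta>\<close>. The constant \<open>B\<close> has to be the same for all \<open>N\<close>, but the scale and the position may depend on \<open>N\<close>.
\<close>
definition rough_progressions :: "real \<Rightarrow> 'a::metric_space set \<Rightarrow> bool" where
  "rough_progressions B E \<longleftrightarrow>
     (\<forall>N. \<exists>p. \<exists>\<delta>>0. (\<forall>i\<le>N. p i \<in> E) \<and>
        (\<forall>i j. i \<le> j \<and> j \<le> (N::nat) \<longrightarrow>
           \<delta> * real (j - i) \<le> dist (p i) (p j) \<and> dist (p i) (p j) \<le> B * (\<delta> * real (j - i))))"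

lemma rough_progressions_similar_image:
  assumes E: "rough_progressions B (g ` F)" and "\<kappa> > 0"
    and sim: "\<And>x y. x \<in> F \<Longrightarrow> y \<in> F \<Longrightarrow> dist (f x) (f y) = \<kappa> * dist (g x) (g y)"
  shows "rough_progressions B (f ` F)"
  unfolding rough_progressions_def
proof
  fix N
  obtain p \<delta> where "\<delta> > 0" and p: "\<And>i. i \<le> N \<Longrightarrow> p i \<in> g ` F"
    and d: "\<And>i j. i \<le> j \<and> j \<le> N \<Longrightarrow>
           \<delta> * real (j - i) \<le> dist (p i) (p j) \<and> dist (p i) (p j) \<le> B * (\<delta> * real (j - i))"
    using E unfolding rough_progressions_def by metis
  obtain q where q: "\<And>i. i \<le> N \<Longrightarrow> q i \<in> F \<and> p i = g (q i)"
  proof -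
    have "\<forall>i. \<exists>x. i \<le> N \<longrightarrow> x \<in> F \<and> p i = g x" using p by blast
    from choice[OF this] that show thesis by blast
  qed
  have "(\<forall>i\<le>N. f (q i) \<in> f ` F) \<and>
        (\<forall>i j. i \<le> j \<and> j \<le> N \<longrightarrow> (\<kappa> * \<delta>) * real (j - i) \<le> dist (f (q i)) (f (q j))
          \<and> dist (f (q i)) (f (q j)) \<le> B * ((\<kappa> * \<delta>) * real (j - i)))"
  proof (intro conjI allI impI)
    fix i j assume ij: "i \<le> j \<and> j \<le> N"
    then have *: "dist (f (q i)) (f (q j)) = \<kappa> * dist (p i) (p j)" using q sim by auto
    show "(\<kappa> * \<delta>) * real (j - i) \<le> dist (f (q i)) (f (q j))"
      using d[OF ij] \<open>\<kappa> > 0\<close> unfolding * mult.assoc by (intro mult_left_mono) auto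
    have "\<kappa> * dist (p i) (p j) \<le> \<kappa> * (B * (\<delta> * real (j - i)))"
      using d[OF ij] \<open>\<kappa> > 0\<close> by (intro mult_left_mono) auto
    then show "dist (f (q i)) (f (q j)) \<le> B * ((\<kappa> * \<delta>) * real (j - i))"
      unfolding * by (simp add: mult_ac)
  qed (use q in auto)
  then show "\<exists>p. \<exists>\<delta>>0. (\<forall>i\<le>N. p i \<in> f ` F) \<and>
        (\<forall>i j. i \<le> j \<and> j \<le> N \<longrightarrow>
           \<delta> * real (j - i) \<le> dist (p i) (p j) \<and> dist (p i) (p j) \<le> B * (\<delta> * real (j - i)))"
    using \<open>\<delta> > 0\<close> \<open>\<kappa> > 0\<close> by (intro exI[of _ "\<lambda>i. f (q i)"] exI[of _ "\<kappa> * \<delta>"]) auto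
qed

text \<open>
  A chain of \<open>N + 1\<close> points forces \<open>N \<le> C' * N powr s\<close> with \<open>C'\<close> independent of \<open>N\<close>; as \<open>N\<close> grows, this excludes
  \<open>s < 1\<close>.
\<close>
lemma assouad_dim_ge_1:
  fixes E :: "'a::euclidean_space set"
  assumes "rough_progressions B E"
  shows "assouad_dim E \<ge> 1"
  unfolding assouad_dim_def
proof (rule Inf_greatest, clarify)
  fix s C :: real
  assume "0 \<le> s" "C > 0" and bound: "\<forall>R>0. \<forall>r\<in>{0<..<R}. \<forall>x\<in>E.
     ereal_of_enat (covering_number r (ball x R \<inter> E)) \<le> ereal (C * (R / r) powr s)"
  have "s \<ge> 1"
  proof (rule ccontr)
    assume "\<not> s \<ge> 1"
    then have "s < 1" by simp
    define D where "D = max 1 B"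
    define C' where "C' = C * (4 * D) powr s"
    have le: "real N \<le> C' * real N powr s" if "N \<ge> 1" for N
    proof -
      obtain p \<delta> where "\<delta> > 0" and p: "\<And>i. i \<le> N \<Longrightarrow> p i \<in> E"
        and d: "\<And>i j. i \<le> j \<and> j \<le> N \<Longrightarrow>
           \<delta> * real (j - i) \<le> dist (p i) (p j) \<and> dist (p i) (p j) \<le> B * (\<delta> * real (j - i))"
        using assms unfolding rough_progressions_def by metis
      \<comment> \<open>The ball of radius \<open>R\<close> about \<open>p 0\<close> holds all \<open>N + 1\<close> points, no two of which
      fit into a set of diameter \<open>r\<close>, while \<open>R / r\<close> is only a constant times \<open>N\<close>.\<close>
      define R where "R = 2 * D * N * \<delta>"
      define r where "r = \<delta> / 2"
      have D: "D \<ge> 1" "B \<le> D" by (auto simp: D_def)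
      have "1 * 1 \<le> D * real N" using D that by (intro mult_mono) auto
      then have "R \<ge> 2 * \<delta>" unfolding R_def using \<open>\<delta> > 0\<close> by (auto simp: mult_ac)
      then have Rr: "R > 0" "r \<in> {0<..<R}" using \<open>\<delta> > 0\<close> by (auto simp: r_def)
      have sep: "r < dist (p i) (p j)" if "i \<le> N" "j \<le> N" "i \<noteq> j" for i j
      proof -
        have *: "r < dist (p i) (p j)" if "i < j" "j \<le> N" for i j
        proof -
          have "\<delta> * 1 \<le> \<delta> * real (j - i)" using that \<open>\<delta> > 0\<close> by (intro mult_left_mono) auto
          also have "\<dots> \<le> dist (p i) (p j)" using d[of i j] that by simp
          finally show ?thesis using \<open>\<delta> > 0\<close> unfolding r_def by simp
        qed
        show ?thesis using *[of i j] *[of j i] that by (cases "i < j") (auto simp: dist_commute)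
      qed
      have inj: "inj_on p {..N}"
      proof (rule inj_onI, rule ccontr)
        fix i j assume "i \<in> {..N}" "j \<in> {..N}" "p i = p j" "i \<noteq> j"
        then show False using sep[of i j] Rr by auto
      qed
      have "p ` {..N} \<subseteq> ball (p 0) R \<inter> E"
      proof clarify
        fix i assume "i \<le> N"
        have "dist (p 0) (p i) \<le> B * (\<delta> * real i)" using d[of 0 i] \<open>i \<le> N\<close> by auto
        also have "\<dots> \<le> D * (\<delta> * real N)"
          using D \<open>\<delta> > 0\<close> \<open>i \<le> N\<close> by (intro mult_mono) auto
        also have "\<dots> < R" using \<open>R > 0\<close> unfolding R_def by (auto simp: mult_ac)
        finally show "p i \<in> ball (p 0) R \<inter> E" using p \<open>i \<le> N\<close> by auto
      qed
      then have "enat (card (p ` {..N})) \<le> covering_number r (ball (p 0) R \<inter> E)"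
        using sep by (intro covering_number_ge) auto
      then have "ereal_of_enat (enat (Suc N)) \<le> ereal_of_enat (covering_number r (ball (p 0) R \<inter> E))"
        unfolding ereal_of_enat_le_iff by (simp add: card_image[OF inj])
      also have "\<dots> \<le> ereal (C * (R / r) powr s)"
        using bound Rr p[of 0] by auto
      finally have "real (Suc N) \<le> C * (R / r) powr s" by simp
      also have "R / r = 4 * D * N" using \<open>\<delta> > 0\<close> unfolding R_def r_def by (simp add: field_simps)
      also have "(4 * D * N) powr s = (4 * D) powr s * real N powr s"
        using D by (intro powr_mult)
      finally show ?thesis by (simp add: C'_def mult_ac)
    qed
    have "C' > 0" using \<open>C > 0\<close> unfolding C'_def D_def by auto
    have bd: "real N \<le> C' powr (1 / (1 - s))" if "N \<ge> 1" for N
    proof -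
      have "real N powr (1 - s) \<le> C'"
        using le[OF that] that by (simp add: powr_diff divide_simps)
      then have "(real N powr (1 - s)) powr (1 / (1 - s)) \<le> C' powr (1 / (1 - s))"
        using \<open>s < 1\<close> by (intro powr_mono2) auto
      then show ?thesis using \<open>s < 1\<close> that by (simp add: powr_powr)
    qed
    obtain N :: nat where "real N > C' powr (1 / (1 - s))" using reals_Archimedean2 by blast
    moreover have "C' powr (1 / (1 - s)) > 0" using \<open>C' > 0\<close> by simp
    ultimately have "N \<ge> 1" by (cases N) auto
    then show False using bd[of N] \<open>real N > _\<close> by simp
  qed
  then show "1 \<le> ereal s" by (simp add: one_ereal_def)
qed

lemma assouad_dim_line_le_1:
  fixes v :: "'a::euclidean_space"
  assumes v: "norm v = 1" and E: "E \<subseteq> range (\<lambda>t. t *\<^sub>R v)"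
  shows "assouad_dim E \<le> 1"
proof -
  have "ereal_of_enat (covering_number r (ball x R \<inter> E)) \<le> ereal (7 * (R / r) powr 1)"
    if Rr: "R > 0" "r \<in> {0<..<R}" and x: "x \<in> E" for R r x
  proof -
    have r: "0 < r" "r < R" using Rr by auto
    obtain t where t: "x = t *\<^sub>R v" using x E by auto
    have dist: "dist (a *\<^sub>R v) (b *\<^sub>R v) = \<bar>a - b\<bar>" for a b
      by (simp add: dist_norm v flip: scaleR_left_diff_distrib)
    define M where "M = \<lceil>2 * R / r\<rceil>"
    \<comment> \<open>Balls of radius \<open>r / 2\<close> centred on the line at spacing \<open>r / 2\<close>.\<close>
    define \<U> where "\<U> = (\<lambda>k::int. ball ((t + k * (r / 2)) *\<^sub>R v) (r / 2)) ` {-M..M}"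
    have "M > 0" using r unfolding M_def by auto
    have "ball x R \<inter> E \<subseteq> \<Union>\<U>"
    proof
      fix y assume y: "y \<in> ball x R \<inter> E"
      then obtain s where s: "y = s *\<^sub>R v" using E by auto
      have "\<bar>t - s\<bar> < R" using y v by (simp add: s t dist)
      define k where "k = \<lfloor>2 * (s - t) / r\<rfloor>"
      have "2 * \<bar>s - t\<bar> / r \<le> 2 * R / r" using r \<open>\<bar>t - s\<bar> < R\<close> by (simp add: divide_simps)
      moreover have "2 * R / r \<le> M" unfolding M_def by linarith
      ultimately have "\<bar>2 * (s - t) / r\<bar> \<le> of_int M" 
        using r by (simp only: abs_mult abs_divide abs_numeral abs_of_pos)
      then have "- of_int M \<le> 2 * (s - t) / r" "2 * (s - t) / r \<le> of_int M" by linarith+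
      then have "k \<in> {-M..M}"
        unfolding k_def atLeastAtMost_iff le_floor_iff floor_le_iff by auto
      moreover have "of_int k \<le> 2 * (s - t) / r" "2 * (s - t) / r < of_int k + 1"
        unfolding k_def by linarith+
      then have "0 \<le> s - (t + k * (r / 2))" "s - (t + k * (r / 2)) < r / 2"
        using r by (simp_all add: field_simps)
      then have "y \<in> ball ((t + k * (r / 2)) *\<^sub>R v) (r / 2)"
        unfolding s mem_ball dist by linarith
      ultimately show "y \<in> \<Union>\<U>" unfolding \<U>_def by blast
    qed
    moreover have "\<forall>U\<in>\<U>. open U \<and> bounded U \<and> diameter U \<le> r" "finite \<U>"
      unfolding \<U>_def using r by auto
    ultimately have "covering_number r (ball x R \<inter> E) \<le> enat (card \<U>)"
      unfolding covering_number_def by (intro Inf_lower) blast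
    then have "ereal_of_enat (covering_number r (ball x R \<inter> E)) \<le> ereal_of_enat (enat (card \<U>))"
      unfolding ereal_of_enat_le_iff .
    also have "\<dots> \<le> ereal (7 * (R / r) powr 1)"
    proof -
      have "card \<U> \<le> card {-M..M}" unfolding \<U>_def by (rule card_image_le) simp
      then have "real (card \<U>) \<le> 2 * M + 1" using \<open>M > 0\<close> by simp
      also have "real_of_int M \<le> 2 * R / r + 1"
        unfolding M_def by (rule of_int_ceiling_le_add_one)
      then have "real_of_int (2 * M + 1) \<le> 2 * (2 * R / r + 1) + 1" by simp
      also have "\<dots> = 4 * (R / r) + 3" by simp
      also have "\<dots> \<le> 7 * (R / r)"
      proof -
        have "1 \<le> R / r" using r by simp
        then show ?thesis by linarith
      qed
      also have "\<dots> = 7 * (R / r) powr 1" using r by simp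
      finally show ?thesis by simp
    qed
    finally show ?thesis .
  qed
  then have "\<exists>C>0. \<forall>R>0. \<forall>r\<in>{0<..<R}. \<forall>x\<in>E.
      ereal_of_enat (covering_number r (ball x R \<inter> E)) \<le> ereal (C * (R / r) powr 1)"
    by (intro exI[of _ "7::real"]) simp
  note exponent_1 = this
  show ?thesis
    unfolding assouad_dim_def one_ereal_def
    by (rule Inf_lower, rule CollectI, rule exI[of _ "1::real"], intro conjI refl zero_le_one exponent_1)
qed

section \<open>Progressions from comparable steps\<close>

lemma telescoped_step_bounds:
  fixes f :: "nat \<Rightarrow> real"
  assumes "u \<noteq> 0" and steps: "\<And>i. i < N \<Longrightarrow> 1 \<le> (f (Suc i) - f i) / u \<and> (f (Suc i) - f i) / u \<le> B"
    and "i \<le> j" "j \<le> N"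
  shows "real (j - i) \<le> (f j - f i) / u \<and> (f j - f i) / u \<le> B * real (j - i)"
  using \<open>i \<le> j\<close> \<open>j \<le> N\<close>
proof (induction j rule: dec_induct)
  case base
  then show ?case by simp
next
  case (step j)
  have eq: "(f (Suc j) - f i) / u = (f j - f i) / u + (f (Suc j) - f j) / u"
    by (simp flip: add_divide_distrib)
  have "real (Suc j - i) = real (j - i) + 1" using step.hyps by simp
  moreover have "B * real (Suc j - i) = B * real (j - i) + B"
    using step.hyps by (simp add: algebra_simps)
  ultimately show ?case using step.IH step.prems steps[of j] unfolding eq by auto
qed

text \<open>
  On the real line it is enough to control consecutive differences, provided they all have
  the same sign. Dividing by \<open>u\<close> covers increasing and decreasing chains alike.
\<close>
lemma rough_progressions_of_steps:
  fixes E :: "real set"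
  assumes "\<And>N. \<exists>p u. u \<noteq> 0 \<and> (\<forall>i\<le>N. p i \<in> E) \<and>
      (\<forall>i<N. 1 \<le> (p (Suc i) - p i) / u \<and> (p (Suc i) - p i) / u \<le> B)"
  shows "rough_progressions B E"
  unfolding rough_progressions_def
proof
  fix N
  obtain p u where "u \<noteq> 0" and p: "\<forall>i\<le>N. p i \<in> E"
      and st: "\<And>i. i < N \<Longrightarrow> 1 \<le> (p (Suc i) - p i) / u \<and> (p (Suc i) - p i) / u \<le> B"
    using assms by blast
  have d: "\<bar>u\<bar> * real (j - i) \<le> dist (p i) (p j) \<and> dist (p i) (p j) \<le> B * (\<bar>u\<bar> * real (j - i))"
    if "i \<le> j" "j \<le> N" for i j
  proof -
    note b = telescoped_step_bounds[where f = p, OF \<open>u \<noteq> 0\<close> st that]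
    have "dist (p i) (p j) = \<bar>u * ((p j - p i) / u)\<bar>"
      using \<open>u \<noteq> 0\<close> by (simp add: dist_real_def)
    also have "\<dots> = \<bar>u\<bar> * ((p j - p i) / u)"
      using b unfolding abs_mult by (metis abs_of_nonneg of_nat_0_le_iff order_trans)
    finally have eq: "dist (p i) (p j) = \<bar>u\<bar> * ((p j - p i) / u)" .
    have "\<bar>u\<bar> * real (j - i) \<le> \<bar>u\<bar> * ((p j - p i) / u)"
         "\<bar>u\<bar> * ((p j - p i) / u) \<le> \<bar>u\<bar> * (B * real (j - i))"
      using b by (intro mult_left_mono; simp)+
    then show ?thesis unfolding eq by (simp only: mult_ac)
  qed
  show "\<exists>p. \<exists>\<delta>>0. (\<forall>i\<le>N. p i \<in> E) \<and>
        (\<forall>i j. i \<le> j \<and> j \<le> N \<longrightarrow>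
           \<delta> * real (j - i) \<le> dist (p i) (p j) \<and> dist (p i) (p j) \<le> B * (\<delta> * real (j - i)))"
    using d p \<open>u \<noteq> 0\<close> by (intro exI[of _ p] exI[of _ "\<bar>u\<bar>"]) simp
qed

section \<open>Orientation-preserving maps with a common linear part\<close>

definition plane_to_complex :: "real^2 \<Rightarrow> complex" where
  "plane_to_complex x = Complex (x $ 1) (x $ 2)"

lemma dist_plane_to_complex: "dist (plane_to_complex x) (plane_to_complex y) = dist x y"
  by (simp add: dist_norm plane_to_complex_def cmod_def norm_vec_def L2_set_def sum_2 complex_diff)

text \<open>
  An orthogonal matrix of size two is a rotation or a reflection according to its determinant, so it acts as
  multiplication by a unit complex number, possibly after conjugation.
\<close>
lemma contracting_similarity_complex:
  assumes "contracting_similarity S"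
  obtains a b where "0 < norm a" "norm a < 1"
    "(\<forall>x. plane_to_complex (S x) = a * plane_to_complex x + b) \<or>
     (\<forall>x. plane_to_complex (S x) = a * cnj (plane_to_complex x) + b)"
proof -
  obtain c t and Q :: "real^2^2" where c: "0 < c" "c < 1" and Q: "orthogonal_matrix Q"
    and S: "\<And>x. S x = c *\<^sub>R (Q *v x) + t"
    using assms unfolding contracting_similarity_def by auto
  define p q r s where pqrs: "p = Q$1$1" "q = Q$1$2" "r = Q$2$1" "s = Q$2$2"
  have "transpose Q ** Q = mat 1" using Q orthogonal_matrix by blast
  then have "(transpose Q ** Q) $ i $ j = (mat 1 :: real^2^2) $ i $ j" for i j by simp
  from this[of 1 1] this[of 1 2] this[of 2 2]
  have 1: "p\<^sup>2 + r\<^sup>2 = 1" "p * q + r * s = 0" "q\<^sup>2 + s\<^sup>2 = 1"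
    by (auto simp: matrix_matrix_mult_def transpose_def mat_def sum_2 pqrs power2_eq_square)
  define a where "a = c *\<^sub>R Complex p r"
  have norm_a: "norm a = c"
  proof -
    have "norm (Complex p r) = 1" using 1(1) by (simp add: cmod_def)
    then show ?thesis using c by (simp add: a_def)
  qed
  have S': "plane_to_complex (S x) =
      Complex (c * (p * x$1 + q * x$2)) (c * (r * x$1 + s * x$2)) + plane_to_complex t" for x
    by (simp add: plane_to_complex_def S matrix_vector_mult_def sum_2 pqrs complex_eq_iff)
  have "(p * s - q * r)\<^sup>2 = (p\<^sup>2 + r\<^sup>2) * (q\<^sup>2 + s\<^sup>2) - (p * q + r * s)\<^sup>2"
    by algebra
  then have "(p * s - q * r)\<^sup>2 = 1" unfolding 1 by simp
  then consider "p * s - q * r = 1" | "p * s - q * r = -1" by (auto simp: power2_eq_1_iff)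
  then show thesis
  proof cases
    case 1
    have "(p - s)\<^sup>2 + (q + r)\<^sup>2 = (p\<^sup>2 + r\<^sup>2) + (q\<^sup>2 + s\<^sup>2) - 2 * (p * s - q * r)" by algebra
    then have "(p - s)\<^sup>2 + (q + r)\<^sup>2 = 0" unfolding 1 \<open>p\<^sup>2 + r\<^sup>2 = 1\<close> \<open>q\<^sup>2 + s\<^sup>2 = 1\<close> by simp
    then have "s = p" "q = - r" by (simp_all add: sum_power2_eq_zero_iff)
    then have "plane_to_complex (S x) = a * plane_to_complex x + plane_to_complex t" for x
      unfolding S' by (simp add: plane_to_complex_def a_def complex_eq_iff algebra_simps)
    then show thesis using that[of a] norm_a c by blast
  next
    case 2
    have "(p + s)\<^sup>2 + (q - r)\<^sup>2 = (p\<^sup>2 + r\<^sup>2) + (q\<^sup>2 + s\<^sup>2) + 2 * (p * s - q * r)" by algebra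
    then have "(p + s)\<^sup>2 + (q - r)\<^sup>2 = 0" unfolding 2 \<open>p\<^sup>2 + r\<^sup>2 = 1\<close> \<open>q\<^sup>2 + s\<^sup>2 = 1\<close> by simp
    then have "s = - p" "q = r" by (simp_all add: sum_power2_eq_zero_iff)
    then have "plane_to_complex (S x) = a * cnj (plane_to_complex x) + plane_to_complex t" for x
      unfolding S' by (simp add: plane_to_complex_def a_def complex_eq_iff algebra_simps)
    then show thesis using that[of a] norm_a c by blast
  qed
qed

lemma contracting_similarity_dist:
  assumes "contracting_similarity S"
  obtains c where "0 < c" "c < 1" "\<And>x y. dist (S x) (S y) = c * dist x y"
proof -
  obtain a b where ab: "0 < norm a" "norm a < 1"
    "(\<forall>x. plane_to_complex (S x) = a * plane_to_complex x + b) \<or>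
     (\<forall>x. plane_to_complex (S x) = a * cnj (plane_to_complex x) + b)"
    using contracting_similarity_complex[OF assms] by metis
  have "dist (S x) (S y) = norm a * dist x y" for x y
  proof -
    have "norm (cnj z - cnj w) = norm (z - w)" for z w :: complex
      by (metis complex_cnj_diff complex_mod_cnj)
    then show ?thesis
      using ab(3) unfolding dist_plane_to_complex[symmetric]
      by (auto simp: dist_norm norm_mult simp flip: right_diff_distrib)
  qed
  then show thesis using that ab by blast
qed

lemma contracting_similarity_compose:
  assumes "contracting_similarity f" "contracting_similarity g"
  shows "contracting_similarity (\<lambda>x. f (g x))"
proof -
  obtain c t and Q :: "real^2^2" where c: "0 < c" "c < 1" and Q: "orthogonal_matrix Q"
    and f: "\<And>x. f x = c *\<^sub>R (Q *v x) + t"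
    using assms unfolding contracting_similarity_def by auto
  obtain c' t' and Q' :: "real^2^2" where c': "0 < c'" "c' < 1" and Q': "orthogonal_matrix Q'"
    and g: "\<And>x. g x = c' *\<^sub>R (Q' *v x) + t'"
    using assms unfolding contracting_similarity_def by auto
  have "f (g x) = (c * c') *\<^sub>R ((Q ** Q') *v x) + (c *\<^sub>R (Q *v t') + t)" for x
    by (simp add: f g matrix_vector_right_distrib scaleR_right_distrib
        matrix_vector_mul_assoc matrix_vector_mult_scaleR algebra_simps)
  moreover have "c * c' < 1" using mult_strict_mono[of c 1 c' 1] c c' by simp
  ultimately show ?thesis
    unfolding contracting_similarity_def
    using c c' Q Q' orthogonal_matrix_mul by (metis mult_pos_pos)
qed

text \<open>
  Every point of the attractor lies in the images of \<open>F\<close> under words of any length in the maps of the IFS, and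
  long words contract strongly.
\<close>
lemma small_word_around_point:
  assumes IFS: "is_IFS I S" and F: "is_attractor I S F" and "x \<in> F" "\<epsilon> > 0"
  obtains f where "contracting_similarity f" "f ` F \<subseteq> F" "\<And>y. y \<in> f ` F \<Longrightarrow> dist y x < \<epsilon>"
proof -
  have "\<forall>i\<in>I. \<exists>c<1. 0 < c \<and> (\<forall>x y. dist (S i x) (S i y) = c * dist x y)"
    using IFS contracting_similarity_dist unfolding is_IFS_def by metis
  then obtain c where c: "\<And>i. i \<in> I \<Longrightarrow> 0 < c i \<and> c i < 1"
      "\<And>i x y. i \<in> I \<Longrightarrow> dist (S i x) (S i y) = c i * dist x y"
    by metis
  define \<rho> where "\<rho> = Max (c ` I)"
  have FS: "F = (\<Union>i\<in>I. S i ` F)" using F unfolding is_attractor_def by blast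
  have "finite I" "I \<noteq> {}" using IFS FS \<open>x \<in> F\<close> unfolding is_IFS_def by auto
  then have \<rho>: "\<rho> < 1" "0 < \<rho>" and le: "\<And>i. i \<in> I \<Longrightarrow> c i \<le> \<rho>"
    unfolding \<rho>_def using c(1) by (auto simp: Max_gr_iff)
  have words: "\<exists>f. contracting_similarity f \<and> f ` F \<subseteq> F \<and> x \<in> f ` F \<and>
      (\<forall>u v. dist (f u) (f v) \<le> \<rho> ^ n * dist u v)" if "x \<in> F" for n x
    using that
  proof (induction n arbitrary: x)
    case 0
    then obtain i where i: "i \<in> I" "x \<in> S i ` F" using FS by blast
    have "S i ` F \<subseteq> F" using i FS by blast
    moreover have "dist (S i u) (S i v) \<le> \<rho> ^ 0 * dist u v" for u v
      using c(1)[OF i(1)] by (simp add: c(2)[OF i(1)] mult_left_le_one_le)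
    ultimately show ?case using i IFS unfolding is_IFS_def by blast
  next
    case (Suc n)
    then obtain i y where i: "i \<in> I" "y \<in> F" "x = S i y" using FS by blast
    obtain f where f: "contracting_similarity f" "f ` F \<subseteq> F" "y \<in> f ` F"
      "\<And>u v. dist (f u) (f v) \<le> \<rho> ^ n * dist u v"
      using Suc.IH[OF i(2)] by blast
    have "S i ` F \<subseteq> F" using i FS by blast
    have "contracting_similarity (\<lambda>z. S i (f z))"
      using contracting_similarity_compose[OF _ f(1)] IFS i(1) unfolding is_IFS_def by blast
    moreover have "dist (S i (f u)) (S i (f v)) \<le> \<rho> ^ Suc n * dist u v" for u v
    proof -
      have "c i * dist (f u) (f v) \<le> \<rho> * (\<rho> ^ n * dist u v)"
        using c(1)[OF i(1)] le[OF i(1)] f(4) \<rho> by (intro mult_mono) auto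
      then show ?thesis by (simp add: c(2)[OF i(1)] mult_ac)
    qed
    moreover have "(\<lambda>z. S i (f z)) ` F \<subseteq> F"
      using f(2) \<open>S i ` F \<subseteq> F\<close> by blast
    moreover have "x \<in> (\<lambda>z. S i (f z)) ` F"
      using f(3) i(3) by blast
    ultimately show ?case by blast
  qed
  have "bounded F" using F compact_imp_bounded unfolding is_attractor_def by blast
  then obtain D' where "\<And>u v. u \<in> F \<Longrightarrow> v \<in> F \<Longrightarrow> dist u v \<le> D'"
    unfolding bounded_two_points by blast
  then obtain D where D: "D > 0" "\<And>u v. u \<in> F \<Longrightarrow> v \<in> F \<Longrightarrow> dist u v \<le> D"
  proof -
    have "\<And>u v. u \<in> F \<Longrightarrow> v \<in> F \<Longrightarrow> dist u v \<le> max D' 1"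
      using \<open>\<And>u v. u \<in> F \<Longrightarrow> v \<in> F \<Longrightarrow> dist u v \<le> D'\<close> by (rule le_max_iff_disj[THEN iffD2, OF disjI1])
    then show thesis using that[of "max D' 1"] by simp
  qed
  \<comment> \<open>A long word maps the whole of the bounded set \<open>F\<close> close to any point of its image.\<close>
  obtain n where n: "\<rho> ^ n < \<epsilon> / D"
    using real_arch_pow_inv[of "\<epsilon> / D" \<rho>] \<rho> D \<open>\<epsilon> > 0\<close> by auto
  obtain f where f: "contracting_similarity f" "f ` F \<subseteq> F" "x \<in> f ` F"
      "\<And>u v. dist (f u) (f v) \<le> \<rho> ^ n * dist u v"
    using words[OF \<open>x \<in> F\<close>] by blast
  obtain w where w: "w \<in> F" "x = f w" using f(3) by blast
  have "dist (f y) x < \<epsilon>" if "y \<in> F" for y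
  proof -
    have "dist (f y) x \<le> \<rho> ^ n * D"
      unfolding w using f(4)[of y w] D(2)[OF that w(1)] \<rho>
      by (meson mult_left_mono order_trans zero_le_power less_imp_le)
    also have "\<dots> < \<epsilon>" using n D by (simp add: pos_less_divide_eq)
    finally show ?thesis .
  qed
  then have "dist y x < \<epsilon>" if "y \<in> f ` F" for y using that by blast
  with f(1,2) show thesis by (rule that)
qed

text \<open>
  The square of a word has the required form even if the word itself reverses orientation: the
  conjugations cancel, and the image only becomes smaller.
\<close>
lemma small_oriented_copies:
  assumes IFS: "is_IFS I S" and F: "is_attractor I S F"
    and z: "z \<in> plane_to_complex ` F" and "\<epsilon> > 0"
  obtains a b where "0 < norm a" "norm a < 1"
    "\<And>y. y \<in> plane_to_complex ` F \<Longrightarrow> a * y + b \<in> plane_to_complex ` F \<and> dist (a * y + b) z < \<epsilon>"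
proof -
  obtain x where x: "x \<in> F" "z = plane_to_complex x" using z by blast
  obtain f where f: "contracting_similarity f" "f ` F \<subseteq> F" "\<And>y. y \<in> f ` F \<Longrightarrow> dist y x < \<epsilon>"
    using small_word_around_point[OF IFS F x(1) \<open>\<epsilon> > 0\<close>] by metis
  obtain a b where ab: "0 < norm a" "norm a < 1"
    "(\<forall>x. plane_to_complex (f x) = a * plane_to_complex x + b) \<or>
     (\<forall>x. plane_to_complex (f x) = a * cnj (plane_to_complex x) + b)"
    using contracting_similarity_complex[OF f(1)] by metis
  have "norm a * norm a < 1" using ab mult_strict_mono[of "norm a" 1 "norm a" 1] by simp
  moreover have "\<exists>A B. norm A = norm a * norm a \<and>
      (\<forall>x. plane_to_complex (f (f x)) = A * plane_to_complex x + B)"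
    using ab(3)
  proof
    assume "\<forall>x. plane_to_complex (f x) = a * plane_to_complex x + b"
    then show ?thesis
      by (intro exI[of _ "a * a"] exI[of _ "a * b + b"]) (simp add: norm_mult algebra_simps)
  next
    assume "\<forall>x. plane_to_complex (f x) = a * cnj (plane_to_complex x) + b"
    then show ?thesis
      by (intro exI[of _ "a * cnj a"] exI[of _ "a * cnj b + b"]) (simp add: norm_mult algebra_simps)
  qed
  then obtain A B where AB: "norm A = norm a * norm a"
      "\<And>x. plane_to_complex (f (f x)) = A * plane_to_complex x + B" by blast
  moreover have "A * y + B \<in> plane_to_complex ` F \<and> dist (A * y + B) z < \<epsilon>"
    if y: "y \<in> plane_to_complex ` F" for y
  proof -
    obtain v where v: "v \<in> F" "y = plane_to_complex v" using y by blast
    have "f (f v) \<in> F" "dist (f (f v)) x < \<epsilon>"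
      using f(2) f(3)[of "f (f v)"] v(1) by blast+
    then show ?thesis unfolding v(2) AB(2)[symmetric] x(2) dist_plane_to_complex by blast
  qed
  moreover have "0 < norm A" unfolding AB(1) using ab(1) by simp
  ultimately show thesis using that[of A B] by simp
qed

text \<open>
  Twice the oriented area of the triangle with vertices \<open>x, y, z\<close>: a continuous quantity that
  vanishes exactly for collinear triples.
\<close>
definition signed_area :: "complex \<Rightarrow> complex \<Rightarrow> complex \<Rightarrow> real" where
  "signed_area x y z = Im (cnj (y - x) * (z - x))"

lemma collinear_if_signed_areas_vanish:
  assumes "\<And>x y z. x \<in> F \<Longrightarrow> y \<in> F \<Longrightarrow> z \<in> F \<Longrightarrow>
     signed_area (plane_to_complex x) (plane_to_complex y) (plane_to_complex z) = 0"
  shows "collinear F"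
proof (cases "\<exists>x\<in>F. \<exists>y\<in>F. x \<noteq> y")
  case True
  then obtain x y where xy: "x \<in> F" "y \<in> F" "x \<noteq> y" by blast
  define p q where "p = y$1 - x$1" and "q = y$2 - x$2"
  have pq: "p\<^sup>2 + q\<^sup>2 \<noteq> 0"
    using xy(3) by (auto simp: p_def q_def vec_eq_iff forall_2 sum_power2_eq_zero_iff)
  have "\<exists>c. z = x + c *\<^sub>R (y - x)" if "z \<in> F" for z
  proof -
    define u v where "u = z$1 - x$1" and "v = z$2 - x$2"
    have "p * v - q * u = 0"
      using assms[OF xy(1,2) that]
      by (simp add: signed_area_def plane_to_complex_def p_def q_def u_def v_def algebra_simps)
    then have "u * (p\<^sup>2 + q\<^sup>2) = (p * u + q * v) * p" "v * (p\<^sup>2 + q\<^sup>2) = (p * u + q * v) * q"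
      by algebra+
    then have "u = (p * u + q * v) / (p\<^sup>2 + q\<^sup>2) * p" "v = (p * u + q * v) / (p\<^sup>2 + q\<^sup>2) * q"
      using pq by (simp_all add: field_simps)
    then have "z = x + ((p * u + q * v) / (p\<^sup>2 + q\<^sup>2)) *\<^sub>R (y - x)"
      unfolding vec_eq_iff forall_2 by (simp add: p_def q_def u_def v_def)
    then show ?thesis by blast
  qed
  then show ?thesis unfolding collinear_alt by blast
next
  case False
  then have "F = {} \<or> (\<exists>x. F = {x})" by blast
  then show ?thesis by auto
qed

lemma signed_area_nonzero_nearby:
  assumes "signed_area x y z \<noteq> 0"
  obtains \<epsilon> where "\<epsilon> > 0" "\<And>x' y' z'. dist x' x < \<epsilon> \<Longrightarrow> dist y' y < \<epsilon> \<Longrightarrow> dist z' z < \<epsilon> \<Longrightarrow>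
     signed_area x' y' z' \<noteq> 0"
proof -
  define W where "W = {t :: complex \<times> complex \<times> complex. signed_area (fst t) (fst (snd t)) (snd (snd t)) \<noteq> 0}"
  have "open W"
    unfolding W_def signed_area_def by (intro open_Collect_neq continuous_intros)
  moreover have "(x, y, z) \<in> W" using assms by (simp add: W_def)
  ultimately obtain X YZ where X: "open X" "open YZ" "(x, y, z) \<in> X \<times> YZ" "X \<times> YZ \<subseteq> W"
    by (rule open_prod_elim)
  from X(3) have "(y, z) \<in> YZ" by simp
  with X(2) obtain Y Z where YZ: "open Y" "open Z" "(y, z) \<in> Y \<times> Z" "Y \<times> Z \<subseteq> YZ"
    by (rule open_prod_elim)
  have "\<exists>e>0. \<forall>u. dist u c < e \<longrightarrow> u \<in> T" if "open T" "c \<in> T" for c :: complex and T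
    using that unfolding open_dist by blast
  from this[of X x] this[of Y y] this[of Z z] obtain e1 e2 e3
    where e: "e1 > 0" "e2 > 0" "e3 > 0" "\<And>u. dist u x < e1 \<Longrightarrow> u \<in> X"
      "\<And>u. dist u y < e2 \<Longrightarrow> u \<in> Y" "\<And>u. dist u z < e3 \<Longrightarrow> u \<in> Z"
    using X YZ by auto
  show thesis
  proof (rule that[of "min e1 (min e2 e3)"])
    fix x' y' z' assume "dist x' x < min e1 (min e2 e3)" "dist y' y < min e1 (min e2 e3)"
      "dist z' z < min e1 (min e2 e3)"
    then have "x' \<in> X" "y' \<in> Y" "z' \<in> Z" using e by auto
    then have "(x', y', z') \<in> W" using X YZ by blast
    then show "signed_area x' y' z' \<noteq> 0" by (simp add: W_def)
  qed (use e in auto)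
qed

lemma signed_area_translate: "signed_area (c + x) (c + y) (c + z) = signed_area x y z"
  by (simp add: signed_area_def)

text \<open>
  Linear parts of orientation-preserving similarities commute, so compositions of the same maps in different
  orders differ by a translation only.
\<close>
lemma maps_with_common_linear_part:
  assumes IFS: "is_IFS I S" and F: "is_attractor I S F" and nc: "\<not> collinear F"
  obtains a b0 b1 b2 where "0 < norm a" "norm a < 1" "signed_area b0 b1 b2 \<noteq> 0"
    "\<And>y b. y \<in> plane_to_complex ` F \<Longrightarrow> b \<in> {b0, b1, b2} \<Longrightarrow> a * y + b \<in> plane_to_complex ` F"
proof -
  let ?F = "plane_to_complex ` F"
  obtain x y z where xyz: "x \<in> ?F" "y \<in> ?F" "z \<in> ?F" "signed_area x y z \<noteq> 0"
    using collinear_if_signed_areas_vanish nc by blast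
  obtain \<epsilon> where \<epsilon>: "\<epsilon> > 0" "\<And>x' y' z'. dist x' x < \<epsilon> \<Longrightarrow> dist y' y < \<epsilon> \<Longrightarrow> dist z' z < \<epsilon> \<Longrightarrow>
     signed_area x' y' z' \<noteq> 0"
    using signed_area_nonzero_nearby[OF xyz(4)] by metis
  obtain a1 c1 where 1: "0 < norm a1" "norm a1 < 1"
      "\<And>v. v \<in> ?F \<Longrightarrow> a1 * v + c1 \<in> ?F \<and> dist (a1 * v + c1) x < \<epsilon>"
    using small_oriented_copies[OF IFS F xyz(1) \<epsilon>(1)] by metis
  obtain a2 c2 where 2: "0 < norm a2" "norm a2 < 1"
      "\<And>v. v \<in> ?F \<Longrightarrow> a2 * v + c2 \<in> ?F \<and> dist (a2 * v + c2) y < \<epsilon>"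
    using small_oriented_copies[OF IFS F xyz(2) \<epsilon>(1)] by metis
  obtain a3 c3 where 3: "0 < norm a3" "norm a3 < 1"
      "\<And>v. v \<in> ?F \<Longrightarrow> a3 * v + c3 \<in> ?F \<and> dist (a3 * v + c3) z < \<epsilon>"
    using small_oriented_copies[OF IFS F xyz(3) \<epsilon>(1)] by metis
  \<comment> \<open>The three cyclic orders of composing the three maps; the map applied last decides
  near which of the three points the image lies.\<close>
  define a where "a = a1 * a2 * a3"
  define b0 where "b0 = a1 * (a2 * c3 + c2) + c1"
  define b1 where "b1 = a2 * (a3 * c1 + c3) + c2"
  define b2 where "b2 = a3 * (a1 * c2 + c1) + c3"
  have g: "a * v + b0 = a1 * (a2 * (a3 * v + c3) + c2) + c1"
          "a * v + b1 = a2 * (a3 * (a1 * v + c1) + c3) + c2"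
          "a * v + b2 = a3 * (a1 * (a2 * v + c2) + c1) + c3" for v
    by (simp_all add: a_def b0_def b1_def b2_def algebra_simps)
  note pos = 1(1) 2(1) 3(1) and less1 = 1(2) 2(2) 3(2)
  have "0 < norm a" using pos by (simp add: a_def norm_mult)
  moreover have "norm a < 1"
  proof -
    have "norm a1 * norm a2 < 1"
      using pos less1 mult_strict_mono[of "norm a1" 1 "norm a2" 1] by simp
    then show ?thesis
      using pos less1 mult_strict_mono[of "norm a1 * norm a2" 1 "norm a3" 1]
      by (simp add: a_def norm_mult)
  qed
  moreover have "signed_area b0 b1 b2 \<noteq> 0"
  proof -
    have "signed_area (a * x + b0) (a * x + b1) (a * x + b2) \<noteq> 0"
      unfolding g using 1(3)[OF conjunct1[OF 2(3)[OF conjunct1[OF 3(3)[OF xyz(1)]]]]]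
        2(3)[OF conjunct1[OF 3(3)[OF conjunct1[OF 1(3)[OF xyz(1)]]]]]
        3(3)[OF conjunct1[OF 1(3)[OF conjunct1[OF 2(3)[OF xyz(1)]]]]]
      by (intro \<epsilon>(2)) simp_all
    then show ?thesis unfolding signed_area_translate .
  qed
  moreover have "a * v + b \<in> ?F" if "v \<in> ?F" "b \<in> {b0, b1, b2}" for v b
  proof -
    have "a * v + b0 \<in> ?F" "a * v + b1 \<in> ?F" "a * v + b2 \<in> ?F"
      unfolding g using 1(3)[OF conjunct1[OF 2(3)[OF conjunct1[OF 3(3)[OF that(1)]]]]]
        2(3)[OF conjunct1[OF 3(3)[OF conjunct1[OF 1(3)[OF that(1)]]]]]
        3(3)[OF conjunct1[OF 1(3)[OF conjunct1[OF 2(3)[OF that(1)]]]]]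
      by simp_all
    then show ?thesis using that(2) by blast
  qed
  ultimately show thesis by (rule that)
qed

section \<open>Chains of points by switching digits\<close>

text \<open>
  Composing \<open>K\<close> maps with linear part \<open>a\<close> and translations \<open>d K, \<dots>, d 1\<close>. Digits are counted from the highest power
  downwards, so that position \<open>j\<close> carries the factor \<open>a ^ (K - j)\<close>. Relative to \<open>a ^ K\<close>, which only
  sets the scale, this factor does not depend on \<open>K\<close>.
\<close>
lemma digit_expansion_in_set:
  fixes a :: complex
  assumes closed: "\<forall>y\<in>F. \<forall>b\<in>D. a * y + b \<in> F"
    and "z \<in> F" and D: "\<And>j. d j \<in> D"
  shows "a ^ K * z + (\<Sum>j=1..K. a ^ (K - j) * d j) \<in> F"
proof (induction K)
  case 0
  then show ?case using \<open>z \<in> F\<close> by simp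
next
  case (Suc K)
  have "(\<Sum>j=1..K. a ^ (Suc K - j) * d j) = a * (\<Sum>j=1..K. a ^ (K - j) * d j)"
    unfolding sum_distrib_left by (intro sum.cong) (auto simp: Suc_diff_le)
  then have "a ^ Suc K * z + (\<Sum>j=1..Suc K. a ^ (Suc K - j) * d j)
     = a * (a ^ K * z + (\<Sum>j=1..K. a ^ (K - j) * d j)) + d (Suc K)"
    by (simp add: algebra_simps)
  then show ?case using closed Suc.IH D by metis
qed

text \<open>
  Two digit sequences \<open>d\<close> and \<open>d'\<close> that are compared block by block: replacing \<open>d\<close> by \<open>d'\<close> on one block of positions
  after the other gives a chain of points of \<open>F\<close> whose successive differences involve one block each.
\<close>
lemma digit_switching:
  fixes a :: complex and m :: "nat \<Rightarrow> nat"
  assumes closed: "\<forall>y\<in>F. \<forall>b\<in>D. a * y + b \<in> F" and "F \<noteq> {}"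
    and D: "\<And>j. d j \<in> D" "\<And>j. d' j \<in> D"
    and m: "mono m" "m N \<le> K"
  shows "\<exists>p. (\<forall>i\<le>N. p i \<in> F) \<and>
    (\<forall>i<N. p (Suc i) - p i = (\<Sum>j\<in>{m i<..m (Suc i)}. a ^ (K - j) * (d' j - d j)))"
proof -
  obtain z where z: "z \<in> F" using \<open>F \<noteq> {}\<close> by blast
  \<comment> \<open>The \<open>i\<close>-th expansion has switched digits up to position \<open>m i\<close>.\<close>
  define h where "h i j = (if j \<le> m i then d' j else d j)" for i j
  define p where "p i = a ^ K * z + (\<Sum>j=1..K. a ^ (K - j) * h i j)" for i
  have "p i \<in> F" for i
    unfolding p_def by (rule digit_expansion_in_set[OF closed z]) (auto simp: h_def D)
  moreover have "p (Suc i) - p i = (\<Sum>j\<in>{m i<..m (Suc i)}. a ^ (K - j) * (d' j - d j))"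
    if "i < N" for i
  proof -
    have "m (Suc i) \<le> K" using monoD[OF m(1), of "Suc i" N] m(2) that by simp
    have "m i \<le> m (Suc i)" using monoD[OF m(1), of i "Suc i"] by simp
    have "p (Suc i) - p i = (\<Sum>j=1..K. a ^ (K - j) * (h (Suc i) j - h i j))"
      by (simp add: p_def right_diff_distrib flip: sum_subtractf)
    also have "\<dots> = (\<Sum>j\<in>{m i<..m (Suc i)}. a ^ (K - j) * (h (Suc i) j - h i j))"
      using \<open>m (Suc i) \<le> K\<close> \<open>m i \<le> m (Suc i)\<close>
      by (intro sum.mono_neutral_right) (auto simp: h_def)
    also have "\<dots> = (\<Sum>j\<in>{m i<..m (Suc i)}. a ^ (K - j) * (d' j - d j))"
      by (intro sum.cong) (auto simp: h_def)
    finally show ?thesis .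
  qed
  ultimately show ?thesis by blast
qed

section \<open>Ratios with irrational rotation\<close>

text \<open>
  Kronecker's approximation theorem for the argument of \<open>\<omega>\<close>, which is an irrational multiple of a full turn.
\<close>
lemma dense_powers_on_circle:
  fixes \<omega> \<zeta> :: complex
  assumes "norm \<omega> = 1" and nonroot: "\<forall>q>0. \<omega> ^ q \<noteq> 1" and "norm \<zeta> = 1" "\<epsilon> > 0"
  obtains n where "n \<ge> n0" "dist (\<omega> ^ n) \<zeta> < \<epsilon>"
proof -
  have "\<exists>t\<in>{0..1}. z = cis (2 * pi * t)" if "norm z = 1" for z
  proof -
    obtain t where t: "0 \<le> t" "t < 2 * pi" "z = Complex (cos t) (sin t)"
      using complex_unimodular_polar[OF \<open>norm z = 1\<close>] by metis
    then have "z = cis (2 * pi * (t / (2 * pi)))" by (simp add: cis.code)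
    moreover have "t / (2 * pi) \<in> {0..1}" using t by (simp add: divide_simps)
    ultimately show ?thesis by blast
  qed
  \<comment> \<open>Aiming at \<open>\<zeta> / \<omega> ^ n0\<close> instead of \<open>\<zeta>\<close> makes room for the prescribed \<open>n0\<close> extra factors.\<close>
  then obtain \<theta> \<alpha> where \<theta>: "\<omega> = cis (2 * pi * \<theta>)"
     and \<alpha>: "\<alpha> \<in> {0..1}" "\<zeta> / \<omega> ^ n0 = cis (2 * pi * \<alpha>)"
    using assms by (metis norm_divide norm_power power_one div_by_1)
  have "\<theta> \<notin> \<rat>"
  proof
    assume "\<theta> \<in> \<rat>"
    then obtain k q :: int where kq: "q > 0" "\<theta> = of_int k / of_int q" by (metis Rats_cases')
    have "\<omega> ^ nat q = cis (2 * pi * of_int k)"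
    proof -
      have "real (nat q) * (2 * pi * \<theta>) = 2 * pi * of_int k" using kq by (simp add: field_simps)
      then show ?thesis unfolding \<theta> Complex.DeMoivre by (rule arg_cong)
    qed
    also have "\<dots> = 1" by (rule cis_multiple_2pi) simp
    finally show False using nonroot kq by simp
  qed
  have "isCont (\<lambda>t. cis (2 * pi * t)) \<alpha>"
    unfolding cis_conv_exp by (intro continuous_intros)
  then obtain e where e: "e > 0" "\<And>t. \<bar>t - \<alpha>\<bar> < e \<Longrightarrow> dist (cis (2 * pi * t)) (cis (2 * pi * \<alpha>)) < \<epsilon>"
    using \<open>\<epsilon> > 0\<close> unfolding continuous_at_eps_delta dist_real_def by metis
  obtain k where k: "k > 0" "\<bar>frac (real k * \<theta>) - \<alpha>\<bar> < e"
    using Kronecker_approx_1_explicit[OF \<open>\<theta> \<notin> \<rat>\<close> _ _ e(1)] \<alpha> by auto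
  have "\<omega> ^ k = cis (2 * pi * frac (real k * \<theta>))"
  proof -
    have "2 * pi * (real k * \<theta>) = 2 * pi * frac (real k * \<theta>) + 2 * pi * of_int \<lfloor>real k * \<theta>\<rfloor>"
      by (simp add: frac_def algebra_simps)
    then have "cis (2 * pi * (real k * \<theta>)) = cis (2 * pi * frac (real k * \<theta>))"
      by (simp flip: cis_mult)
    then show ?thesis unfolding \<theta> Complex.DeMoivre by (simp add: mult_ac)
  qed
  then have "dist (\<omega> ^ k) (\<zeta> / \<omega> ^ n0) < \<epsilon>" using e(2)[OF k(2)] \<alpha> by simp
  moreover have "\<omega> ^ (n0 + k) - \<zeta> = \<omega> ^ n0 * (\<omega> ^ k - \<zeta> / \<omega> ^ n0)"
    using assms(1) by (auto simp: power_add field_simps)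
  then have "dist (\<omega> ^ (n0 + k)) \<zeta> = dist (\<omega> ^ k) (\<zeta> / \<omega> ^ n0)"
    by (simp add: dist_norm norm_mult norm_power assms(1))
  ultimately show thesis using that[of "n0 + k"] by simp
qed

text \<open>
  The set \<open>V\<close> consists of admissible values for a rescaled digit difference \<open>v\<close>; the condition asks
  that all the quantities \<open>v / a ^ n\<close>, although of very different moduli, have comparable real parts. Given a
  solution for \<open>N\<close> exponents, density of the arguments provides a further, much larger exponent \<open>k\<close> and
  a point \<open>v\<close> of \<open>V\<close> for which \<open>v / a ^ k\<close> is almost imaginary with real part \<open>3/2\<close>; the conditions
  already met persist, since \<open>V\<close> is open.
\<close>
lemma nested_directions:
  fixes a :: complex
  assumes a: "0 < norm a" "norm a < 1" and nonroot: "\<forall>q>0. sgn a ^ q \<noteq> 1"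
  shows "\<exists>V n. open V \<and> V \<noteq> {} \<and> 0 \<notin> V \<and> (\<forall>i<N. n i < (n (Suc i) :: nat)) \<and>
     (\<forall>i<N. \<forall>v\<in>V. 1 \<le> Re (v / a ^ n (Suc i)) \<and> Re (v / a ^ n (Suc i)) \<le> 2)"
proof (induction N)
  case 0
  show ?case by (intro exI[of _ "- {0}"]) (auto intro: exI[of _ 1])
next
  case (Suc N)
  then obtain V n where V: "open V" "V \<noteq> {}" "0 \<notin> V" and n: "\<forall>i<N. n i < (n (Suc i) :: nat)"
    and Vn: "\<forall>i<N. \<forall>v\<in>V. 1 \<le> Re (v / a ^ n (Suc i)) \<and> Re (v / a ^ n (Suc i)) \<le> 2" by blast
  obtain v0 where v0: "v0 \<in> V" "v0 \<noteq> 0" using V by blast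
  obtain e where e: "e > 0" "ball v0 e \<subseteq> V" using V v0 open_contains_ball by blast
  obtain M where M: "norm a ^ M < e / 4" using real_arch_pow_inv[of "e/4" "norm a"] a e by auto
  have "norm (sgn a) = 1" using a by (simp add: norm_sgn)
  have "norm (sgn v0 / \<i>) = 1" "e / (4 * norm v0) > 0" using v0 e by (simp_all add: norm_divide norm_mult norm_sgn)
  then obtain k where k: "k \<ge> max M (Suc (n N))" "dist (sgn a ^ k) (sgn v0 / \<i>) < e / (4 * norm v0)"
    using dense_powers_on_circle[OF \<open>norm (sgn a) = 1\<close> nonroot] by blast
  \<comment> \<open>The perturbation \<open>3/2 * norm a ^ k\<close> puts the real part of \<open>v / a ^ k\<close> at \<open>3/2\<close>, in the middle
  of the allowed range; up to it, \<open>v\<close> is \<open>v0\<close> with its argument slightly changed.\<close>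
  define v where "v = sgn a ^ k * (of_real (3/2 * norm a ^ k) + \<i> * of_real (norm v0))"
  have "a ^ k = of_real (norm a ^ k) * sgn a ^ k"
    using a by (simp add: sgn_eq power_divide)
  then have v_div: "v / a ^ k = of_real (3/2) + \<i> * of_real (norm v0 / norm a ^ k)"
    using a by (simp add: v_def sgn_zero_iff field_simps)
  have "v0 = sgn v0 / \<i> * (\<i> * of_real (norm v0))" using v0 by (simp add: sgn_eq field_simps)
  then have "v - v0 = sgn a ^ k * of_real (3/2 * norm a ^ k)
      + (sgn a ^ k - sgn v0 / \<i>) * (\<i> * of_real (norm v0))"
    unfolding v_def by (simp add: algebra_simps)
  then have "norm (v - v0) \<le> norm (sgn a ^ k * of_real (3/2 * norm a ^ k))
      + norm ((sgn a ^ k - sgn v0 / \<i>) * (\<i> * of_real (norm v0)))"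
    by (metis norm_triangle_ineq)
  also have "\<dots> = 3/2 * norm a ^ k + dist (sgn a ^ k) (sgn v0 / \<i>) * norm v0"
    using \<open>norm (sgn a) = 1\<close> by (simp add: norm_mult norm_power dist_norm)
  also have "\<dots> < 3/2 * (e / 4) + e / (4 * norm v0) * norm v0"
  proof (rule add_strict_mono)
    have "norm a ^ k \<le> norm a ^ M" using a k by (intro power_decreasing) auto
    then show "3/2 * norm a ^ k < 3/2 * (e / 4)" using M by simp
    show "dist (sgn a ^ k) (sgn v0 / \<i>) * norm v0 < e / (4 * norm v0) * norm v0"
      using k v0 by (intro mult_strict_right_mono) auto
  qed
  also have "\<dots> < e" using e v0 by (simp add: field_simps)
  finally have "v \<in> V" using e by (auto simp: dist_norm norm_minus_commute)
  define V' where "V' = V \<inter> {x. 1 < Re (x / a ^ k)} \<inter> {x. Re (x / a ^ k) < 2}"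
  have "open V'"
    unfolding V'_def using V a by (intro open_Int open_Collect_less continuous_intros) auto
  moreover have "Re (v / a ^ k) = 3/2" unfolding v_div by simp
  then have "v \<in> V'" using \<open>v \<in> V\<close> unfolding V'_def by simp
  moreover have "0 \<notin> V'" using V by (simp add: V'_def)
  moreover define n' where "n' = n(Suc N := k)"
  have "\<forall>i<Suc N. n' i < n' (Suc i)"
    using n k by (auto simp: n'_def less_Suc_eq)
  moreover have "\<forall>i<Suc N. \<forall>x\<in>V'. 1 \<le> Re (x / a ^ n' (Suc i)) \<and> Re (x / a ^ n' (Suc i)) \<le> 2"
    using Vn by (auto simp: n'_def V'_def less_Suc_eq)
  ultimately show ?case by blast
qed

text \<open>
  By density, \<open>a ^ K * (b1 - b0)\<close> is a positive multiple of an element of \<open>V\<close> for some large \<open>K\<close>. Switching the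
  digit at position \<open>n i\<close> then moves the real part by a uniformly comparable amount.
\<close>
lemma rough_progressions_irrational_rotation:
  fixes a :: complex
  assumes a: "0 < norm a" "norm a < 1" and nonroot: "\<forall>q>0. sgn a ^ q \<noteq> 1"
    and closed: "\<forall>y\<in>F. \<forall>b\<in>{b0, b1}. a * y + b \<in> F" and "F \<noteq> {}" "b0 \<noteq> b1"
  shows "rough_progressions 2 (Re ` F)"
proof (rule rough_progressions_of_steps)
  fix N
  obtain V n where V: "open V" "V \<noteq> {}" "0 \<notin> V" and n: "\<forall>i<N. n i < (n (Suc i) :: nat)"
    and Vn: "\<forall>i<N. \<forall>v\<in>V. 1 \<le> Re (v / a ^ n (Suc i)) \<and> Re (v / a ^ n (Suc i)) \<le> 2"
    using nested_directions[OF a nonroot, of N] by (elim exE conjE) (rule that)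
  obtain v0 where v0: "v0 \<in> V" "v0 \<noteq> 0" using V by blast
  obtain e where e: "e > 0" "ball v0 e \<subseteq> V" using V v0 open_contains_ball by blast
  \<comment> \<open>Held constant beyond \<open>N\<close>, because only the first \<open>N\<close> exponents are known to increase.\<close>
  define m where "m i = n (min i N)" for i
  have "m i \<le> m (Suc i)" for i
    using n[rule_format, of i] by (cases "i < N") (auto simp: m_def min_def)
  then have "mono m" by (simp add: mono_iff_le_Suc)
  define \<epsilon> where "\<epsilon> = b1 - b0"
  have "\<epsilon> \<noteq> 0" using \<open>b0 \<noteq> b1\<close> by (simp add: \<epsilon>_def)
  have "norm (sgn a) = 1" using a by (simp add: norm_sgn)
  have "norm (sgn v0 / sgn \<epsilon>) = 1" "e / norm v0 > 0"
    using v0 e \<open>\<epsilon> \<noteq> 0\<close> by (simp_all add: norm_divide norm_sgn)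
  then obtain K where K: "K \<ge> m N" "dist (sgn a ^ K) (sgn v0 / sgn \<epsilon>) < e / norm v0"
    using dense_powers_on_circle[OF \<open>norm (sgn a) = 1\<close> nonroot] by blast
  define v where "v = sgn a ^ K * sgn \<epsilon> * of_real (norm v0)"
  define u where "u = norm a ^ K * norm \<epsilon> / norm v0"
  have "u \<noteq> 0" using a v0 \<open>\<epsilon> \<noteq> 0\<close> by (simp add: u_def)
  have "a ^ K = of_real (norm a ^ K) * sgn a ^ K"
    using a by (simp add: sgn_eq power_divide)
  moreover have "\<epsilon> = of_real (norm \<epsilon>) * sgn \<epsilon>" using \<open>\<epsilon> \<noteq> 0\<close> by (simp add: sgn_eq)
  ultimately have "a ^ K * \<epsilon> = of_real (norm a ^ K) * sgn a ^ K * (of_real (norm \<epsilon>) * sgn \<epsilon>)"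
    by metis
  also have "\<dots> = of_real u * v" using v0 by (simp add: u_def v_def)
  finally have uv: "a ^ K * \<epsilon> = of_real u * v" .
  have "v0 = sgn v0 / sgn \<epsilon> * sgn \<epsilon> * of_real (norm v0)"
    using v0 \<open>\<epsilon> \<noteq> 0\<close> by (simp add: sgn_eq)
  then have "v - v0 = (sgn a ^ K - sgn v0 / sgn \<epsilon>) * sgn \<epsilon> * of_real (norm v0)"
    unfolding v_def by (simp add: algebra_simps)
  then have "dist v0 v = dist (sgn a ^ K) (sgn v0 / sgn \<epsilon>) * norm v0"
    using \<open>\<epsilon> \<noteq> 0\<close> by (simp add: norm_mult dist_norm norm_sgn norm_minus_commute[of v0])
  also have "\<dots> < e" using K v0 by (simp add: pos_less_divide_eq)
  finally have "v \<in> V" using e by auto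
  define d' where "d' j = (if j \<in> m ` {1..N} then b1 else b0)" for j
  have digits: "b0 \<in> {b0, b1}" "d' j \<in> {b0, b1}" for j by (simp_all add: d'_def)
  obtain p where p: "\<forall>i\<le>N. p i \<in> F"
    "\<forall>i<N. p (Suc i) - p i = (\<Sum>j\<in>{m i<..m (Suc i)}. a ^ (K - j) * (d' j - b0))"
    using digit_switching[of F "{b0, b1}" a "\<lambda>_. b0" d' m N K,
          OF closed \<open>F \<noteq> {}\<close> digits \<open>mono m\<close> K(1)]
    by (elim exE conjE) (rule that)
  have "p (Suc i) - p i = of_real u * (v / a ^ m (Suc i))" if "i < N" for i
  proof -
    have less: "m i < m (Suc i)" using n that by (simp add: m_def)
    have "m (Suc i) \<le> K" using monoD[OF \<open>mono m\<close>, of "Suc i" N] K(1) that by simp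
    have "d' j = b0" if "j \<in> {m i<..m (Suc i)} - {m (Suc i)}" for j
    proof -
      have "j \<noteq> m l" for l
        using that monoD[OF \<open>mono m\<close>, of l i] monoD[OF \<open>mono m\<close>, of "Suc i" l]
        by (cases "l \<le> i") auto
      then show ?thesis by (auto simp: d'_def)
    qed
    then have "p (Suc i) - p i = (\<Sum>j\<in>{m (Suc i)}. a ^ (K - j) * (d' j - b0))"
      unfolding p(2)[rule_format, OF that] using less by (intro sum.mono_neutral_right) auto
    also have "\<dots> = a ^ (K - m (Suc i)) * \<epsilon>"
      using that by (auto simp: d'_def \<epsilon>_def)
    also have "\<dots> = a ^ K * \<epsilon> / a ^ m (Suc i)"
      using a \<open>m (Suc i) \<le> K\<close> by (simp add: power_diff)
    finally show ?thesis unfolding uv by simp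
  qed
  then have "Re (p (Suc i) - p i) = u * Re (v / a ^ m (Suc i))" if "i < N" for i
    using that by (simp only: Re_complex_of_real Im_complex_of_real times_complex.sel mult_zero_left diff_zero)
  then have step: "(Re (p (Suc i)) - Re (p i)) / u = Re (v / a ^ n (Suc i))" if "i < N" for i
    using that \<open>u \<noteq> 0\<close> by (simp add: m_def)
  have "1 \<le> Re (v / a ^ n (Suc i)) \<and> Re (v / a ^ n (Suc i)) \<le> 2" if "i < N" for i
    using Vn \<open>v \<in> V\<close> that by blast
  then show "\<exists>p u. u \<noteq> 0 \<and> (\<forall>i\<le>N. p i \<in> Re ` F) \<and>
      (\<forall>i<N. 1 \<le> (p (Suc i) - p i) / u \<and> (p (Suc i) - p i) / u \<le> 2)"
    using p(1) \<open>u \<noteq> 0\<close>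
    by (intro exI[of _ "\<lambda>i. Re (p i)"] exI[of _ u]) (simp add: step)
qed

section \<open>Positive real ratios\<close>

text \<open>
  The tails of the lacunary series are comparable to their first terms.
\<close>
lemma lacunary_sum:
  fixes c :: real
  assumes c: "0 < c" "c < 1"
  shows "summable (\<lambda>l. c ^ (3 ^ (l + i)))"
    and "c ^ (3 ^ i) \<le> (\<Sum>l. c ^ (3 ^ (l + i)))"
    and "(\<Sum>l. c ^ (3 ^ (l + i))) \<le> c ^ (3 ^ i) * (1 / (1 - c))"
proof -
  have le: "c ^ (3 ^ (l + i)) \<le> c ^ (3 ^ i) * c ^ l" for l
  proof -
    have "1 + l \<le> 3 ^ l" by (induction l) auto
    have "3 ^ i + l \<le> (1 + l) * 3 ^ i" by simp
    also have "\<dots> \<le> 3 ^ l * 3 ^ i" using \<open>1 + l \<le> 3 ^ l\<close> by (rule mult_right_mono) simp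
    finally have "3 ^ i + l \<le> 3 ^ (l + i)" unfolding power_add .
    then show ?thesis using c by (simp add: power_decreasing flip: power_add)
  qed
  have geo: "summable (\<lambda>l. c ^ (3 ^ i) * c ^ l)"
    using c by (intro summable_mult summable_geometric) simp
  show sm: "summable (\<lambda>l. c ^ (3 ^ (l + i)))"
    using le c by (intro summable_comparison_test'[OF geo, of 0]) simp
  have "(\<Sum>l\<in>{0}. c ^ (3 ^ (l + i))) \<le> (\<Sum>l. c ^ (3 ^ (l + i)))"
    using c by (intro sum_le_suminf sm) simp_all
  then show "c ^ (3 ^ i) \<le> (\<Sum>l. c ^ (3 ^ (l + i)))" by simp
  have "(\<Sum>l. c ^ (3 ^ (l + i))) \<le> (\<Sum>l. c ^ (3 ^ i) * c ^ l)"
    by (intro suminf_le le sm geo)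
  also have "\<dots> = c ^ (3 ^ i) * (1 / (1 - c))"
    using c by (simp add: suminf_mult suminf_geometric summable_geometric)
  finally show "(\<Sum>l. c ^ (3 ^ (l + i))) \<le> c ^ (3 ^ i) * (1 / (1 - c))" .
qed

lemma power_of_3_in_block:
  assumes "(3::nat) ^ i < 3 ^ k" "(3::nat) ^ k \<le> 3 ^ Suc i"
  shows "k = Suc i"
proof -
  have "i < k" using assms(1) by (rule power_less_imp_less_exp[rotated]) simp
  moreover have "k \<le> Suc i" using assms(2) by (rule power_le_imp_le_exp[rotated]) simp
  ultimately show ?thesis by simp
qed

text \<open>
  Since \<open>3 ^ k - 3 ^ l \<ge> 2 * 3 ^ (k - 1)\<close> for \<open>l < k\<close>, all the positions used for the exponent \<open>3 ^ k\<close>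
  lie strictly above \<open>3 ^ (k - 1)\<close>.
\<close>
lemma difference_of_powers_of_3_in_block:
  assumes "l < k" "(3::nat) ^ i < 3 ^ k - 3 ^ l" "(3::nat) ^ k - 3 ^ l \<le> 3 ^ Suc i"
  shows "k = Suc i"
proof -
  obtain k' where k': "k = Suc k'" "l \<le> k'" using assms(1) by (cases k) auto
  have "(3::nat) ^ l \<le> 3 ^ k'" using k' by (intro power_increasing) auto
  then have "2 * (3::nat) ^ k' \<le> 3 ^ k - 3 ^ l" unfolding k'(1) power_Suc by linarith
  then have "(2::nat) * 3 ^ k' \<le> 3 ^ Suc i" using assms(3) by linarith
  moreover have "(0::nat) < 3 ^ k'" by simp
  ultimately have "(3::nat) ^ k' < 3 ^ Suc i" by linarith
  then have "k' < Suc i" by (rule power_less_imp_less_exp[rotated]) simp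
  moreover have "(3::nat) ^ i < 3 ^ k" using assms(2) by linarith
  then have "i < k" by (rule power_less_imp_less_exp[rotated]) simp
  ultimately show ?thesis using k' by simp
qed

text \<open>
  Within one block, \<open>d'\<close> has the digit \<open>b2\<close> at its last position \<open>M = 3 ^ Suc i\<close>, and \<open>d\<close> has the digit \<open>b1\<close> at the positions
  \<open>M - 3 ^ l\<close>, whose powers of \<open>c\<close> are \<open>c ^ (3 ^ l)\<close> relative to that of \<open>M\<close>; all other digits are \<open>b0\<close>.
\<close>
lemma lacunary_block_sum:
  fixes c :: real and b0 b1 b2 :: complex
  defines "d \<equiv> \<lambda>j. if \<exists>k l. l < k \<and> j = (3::nat) ^ k - 3 ^ l then b1 else b0"
    and "d' \<equiv> \<lambda>j. if \<exists>k. j = (3::nat) ^ k then b2 else b0"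
  assumes K: "3 ^ Suc i \<le> K"
  shows "(\<Sum>j\<in>{3 ^ i<..3 ^ Suc i}. of_real c ^ (K - j) * (d' j - d j)) =
    c ^ (K - 3 ^ Suc i) *\<^sub>R ((b2 - b0) - (\<Sum>l<Suc i. c ^ (3 ^ l)) *\<^sub>R (b1 - b0))"
proof -
  let ?A = "{3 ^ i<..3 ^ Suc i} :: nat set"
  let ?C = "of_real c :: complex"
  let ?f = "\<lambda>l. 3 ^ Suc i - (3::nat) ^ l"
  have pw: "(3::nat) ^ l \<le> 3 ^ i" if "l < Suc i" for l
    using that by (intro power_increasing) auto
  have f_in: "?f ` {..<Suc i} \<subseteq> ?A"
  proof (rule image_subsetI)
    fix l assume "l \<in> {..<Suc i}"
    then have "(3::nat) ^ l \<le> 3 ^ i" using pw by simp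
    moreover have "(0::nat) < 3 ^ l" "(0::nat) < 3 ^ i" by simp_all
    moreover have "(3::nat) ^ Suc i = 3 * 3 ^ i" by simp
    ultimately show "?f l \<in> ?A" unfolding greaterThanAtMost_iff by linarith
  qed
  have inj: "inj_on ?f {..<Suc i}"
  proof (rule inj_onI)
    fix l k assume lk: "l \<in> {..<Suc i}" "k \<in> {..<Suc i}" "?f l = ?f k"
    have "(3::nat) ^ l \<le> 3 ^ Suc i" "(3::nat) ^ k \<le> 3 ^ Suc i"
      using lk by (intro power_increasing; simp)+
    then have "(3::nat) ^ l = 3 ^ k" using lk(3) by linarith
    then show "l = k" by simp
  qed
  have "d' j - b0 = (if j = 3 ^ Suc i then b2 - b0 else 0)" if "j \<in> ?A" for j
  proof -
    have "(\<exists>k. j = 3 ^ k) \<longleftrightarrow> j = 3 ^ Suc i"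
      using that power_of_3_in_block by (metis greaterThanAtMost_iff)
    then show ?thesis unfolding d'_def by simp
  qed
  then have "(\<Sum>j\<in>?A. ?C ^ (K - j) * (d' j - b0)) =
      (\<Sum>j\<in>?A. if j = 3 ^ Suc i then ?C ^ (K - j) * (b2 - b0) else 0)"
    by (intro sum.cong) auto
  also have "\<dots> = ?C ^ (K - 3 ^ Suc i) * (b2 - b0)"
    by (simp add: sum.delta)
  finally have 1: "(\<Sum>j\<in>?A. ?C ^ (K - j) * (d' j - b0)) = ?C ^ (K - 3 ^ Suc i) * (b2 - b0)" .
  have "d j - b0 = (if j \<in> ?f ` {..<Suc i} then b1 - b0 else 0)" if "j \<in> ?A" for j
  proof -
    have "(\<exists>k l. l < k \<and> j = 3 ^ k - 3 ^ l) \<longleftrightarrow> j \<in> ?f ` {..<Suc i}"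
    proof
      assume "\<exists>k l. l < k \<and> j = 3 ^ k - 3 ^ l"
      then obtain k l where kl: "l < k" "j = 3 ^ k - 3 ^ l" by blast
      then have "k = Suc i"
        using that by (intro difference_of_powers_of_3_in_block[OF kl(1)]) auto
      then show "j \<in> ?f ` {..<Suc i}" using kl by blast
    qed blast
    then show ?thesis unfolding d_def by simp
  qed
  then have "(\<Sum>j\<in>?A. ?C ^ (K - j) * (d j - b0)) =
      (\<Sum>j\<in>?A. if j \<in> ?f ` {..<Suc i} then ?C ^ (K - j) * (b1 - b0) else 0)"
    by (intro sum.cong) auto
  also have "\<dots> = (\<Sum>j\<in>?f ` {..<Suc i}. ?C ^ (K - j) * (b1 - b0))"
    using f_in by (simp add: sum.inter_restrict[symmetric] Int_absorb1)
  also have "\<dots> = (\<Sum>l<Suc i. ?C ^ (K - ?f l) * (b1 - b0))"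
    by (rule sum.reindex_cong[OF inj refl refl])
  also have "\<dots> = (\<Sum>l<Suc i. ?C ^ (K - 3 ^ Suc i) * (?C ^ (3 ^ l) * (b1 - b0)))"
  proof (rule sum.cong[OF refl])
    fix l assume "l \<in> {..<Suc i}"
    then have "(3::nat) ^ l \<le> 3 ^ Suc i" by (intro power_increasing) auto
    then have "K - ?f l = (K - 3 ^ Suc i) + 3 ^ l" using K by linarith
    then show "?C ^ (K - ?f l) * (b1 - b0) = ?C ^ (K - 3 ^ Suc i) * (?C ^ (3 ^ l) * (b1 - b0))"
      by (simp only: power_add mult.assoc)
  qed
  also have "\<dots> = ?C ^ (K - 3 ^ Suc i) * ((\<Sum>l<Suc i. ?C ^ (3 ^ l)) * (b1 - b0))"
    by (simp only: sum_distrib_left sum_distrib_right)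
  finally have 2: "(\<Sum>j\<in>?A. ?C ^ (K - j) * (d j - b0)) =
      ?C ^ (K - 3 ^ Suc i) * ((\<Sum>l<Suc i. ?C ^ (3 ^ l)) * (b1 - b0))" .
  have "(\<Sum>j\<in>?A. ?C ^ (K - j) * (d' j - d j)) =
      (\<Sum>j\<in>?A. ?C ^ (K - j) * (d' j - b0)) - (\<Sum>j\<in>?A. ?C ^ (K - j) * (d j - b0))"
    unfolding sum_subtractf[symmetric] by (intro sum.cong refl) (simp add: algebra_simps)
  also have "\<dots> = c ^ (K - 3 ^ Suc i) *\<^sub>R ((b2 - b0) - (\<Sum>l<Suc i. c ^ (3 ^ l)) *\<^sub>R (b1 - b0))"
    unfolding 1 2 scaleR_conv_of_real by (simp add: right_diff_distrib)
  finally show ?thesis .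
qed

text \<open>
  In the chosen direction the two alternatives of a block agree up to a tail of the lacunary series, and the size of
  this tail is inverse to the power of \<open>c\<close> lost by the position of the block. So every switch
  moves the projection by \<open>c ^ K\<close> times a bounded factor.
\<close>
lemma rough_progressions_real_ratio:
  fixes c :: real
  assumes c: "0 < c" "c < 1"
    and closed: "\<forall>y\<in>F. \<forall>b\<in>{b0, b1, b2}. of_real c * y + b \<in> F"
    and "F \<noteq> {}" and area: "signed_area b0 b1 b2 \<noteq> 0"
  shows "\<exists>w\<noteq>0. rough_progressions (1 / (1 - c)) ((\<lambda>z. z \<bullet> w) ` F)"
proof -
  define T where "T i = (\<Sum>l. c ^ (3 ^ (l + i)))" for i :: nat
  define e1 e2 where "e1 = b1 - b0" and "e2 = b2 - b0"
  \<comment> \<open>Chosen orthogonal to \<open>e2 - T 0 *\<^sub>R e1\<close>, so that \<open>e2\<close> projects to \<open>T 0\<close> times the projection of \<open>e1\<close>.\<close>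
  define w where "w = \<i> * (e2 - T 0 *\<^sub>R e1)"
  have e1w: "e1 \<bullet> w = - signed_area b0 b1 b2"
    by (simp add: w_def signed_area_def e1_def[symmetric] e2_def[symmetric] inner_complex_def algebra_simps)
  have "(e2 - T 0 *\<^sub>R e1) \<bullet> w = 0"
    by (simp add: w_def inner_complex_def algebra_simps)
  then have e2w: "e2 \<bullet> w = T 0 * (e1 \<bullet> w)" by (simp add: inner_diff_left)
  have "e1 \<bullet> w \<noteq> 0" using e1w area by simp
  then have "w \<noteq> 0" by auto
  moreover have "rough_progressions (1 / (1 - c)) ((\<lambda>z. z \<bullet> w) ` F)"
  proof (rule rough_progressions_of_steps)
    fix N
    define K where "K = (3::nat) ^ N"
    \<comment> \<open>Up to \<open>b0\<close>, switching block \<open>i\<close> replaces the truncation of the series for \<open>T 0 * e1\<close>, shifted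
    to the end of the block, by a single digit \<open>e2\<close> there.\<close>
    define d where "d j = (if \<exists>k l. l < k \<and> j = (3::nat) ^ k - 3 ^ l then b1 else b0)" for j
    define d' where "d' j = (if \<exists>k. j = (3::nat) ^ k then b2 else b0)" for j
    define u where "u = c ^ K * (e1 \<bullet> w)"
    have "u \<noteq> 0" using c \<open>e1 \<bullet> w \<noteq> 0\<close> by (simp add: u_def)
    have digits: "d j \<in> {b0, b1, b2}" "d' j \<in> {b0, b1, b2}" for j by (simp_all add: d_def d'_def)
    have "mono (\<lambda>i. (3::nat) ^ i)" by (intro monoI power_increasing) auto
    obtain p where p: "\<forall>i\<le>N. p i \<in> F"
      "\<forall>i<N. p (Suc i) - p i = (\<Sum>j\<in>{3 ^ i<..3 ^ Suc i}. of_real c ^ (K - j) * (d' j - d j))"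
      using digit_switching[of F "{b0, b1, b2}" "of_real c" d d' "\<lambda>i. 3 ^ i" N K,
          OF closed \<open>F \<noteq> {}\<close> digits \<open>mono (\<lambda>i. 3 ^ i)\<close> eq_refl[OF K_def[symmetric]]]
      by (elim exE conjE) (rule that)
    have step: "(p (Suc i) \<bullet> w - p i \<bullet> w) / u = T (Suc i) / c ^ (3 ^ Suc i)" if "i < N" for i
    proof -
      have le: "3 ^ Suc i \<le> K" unfolding K_def using that by (intro power_increasing) auto
      have "p (Suc i) - p i = c ^ (K - 3 ^ Suc i) *\<^sub>R (e2 - (\<Sum>l<Suc i. c ^ (3 ^ l)) *\<^sub>R e1)"
        unfolding p(2)[rule_format, OF that] d_def d'_def e1_def e2_def
        by (rule lacunary_block_sum[OF le])
      then have "(p (Suc i) - p i) \<bullet> w =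
          c ^ (K - 3 ^ Suc i) * ((T 0 - (\<Sum>l<Suc i. c ^ (3 ^ l))) * (e1 \<bullet> w))"
        by (simp only: inner_scaleR_left inner_diff_left e2w left_diff_distrib)
      also have "T 0 - (\<Sum>l<Suc i. c ^ (3 ^ l)) = T (Suc i)"
        using suminf_split_initial_segment[OF lacunary_sum(1)[OF c, of 0], of "Suc i"]
        unfolding T_def by simp
      finally have "p (Suc i) \<bullet> w - p i \<bullet> w = c ^ (K - 3 ^ Suc i) * (T (Suc i) * (e1 \<bullet> w))"
        by (simp only: inner_diff_left)
      moreover have "c ^ K = c ^ (K - 3 ^ Suc i) * c ^ (3 ^ Suc i)"
        using le by (simp flip: power_add)
      ultimately show ?thesis
        using c \<open>e1 \<bullet> w \<noteq> 0\<close> unfolding u_def by simp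
    qed
    have "1 \<le> T i / c ^ (3 ^ i) \<and> T i / c ^ (3 ^ i) \<le> 1 / (1 - c)" for i
      using lacunary_sum(2,3)[OF c, of i] c unfolding T_def
      by (simp add: pos_le_divide_eq pos_divide_le_eq mult.commute)
    then show "\<exists>p u. u \<noteq> 0 \<and> (\<forall>i\<le>N. p i \<in> (\<lambda>z. z \<bullet> w) ` F) \<and>
      (\<forall>i<N. 1 \<le> (p (Suc i) - p i) / u \<and> (p (Suc i) - p i) / u \<le> 1 / (1 - c))"
      using p(1) \<open>u \<noteq> 0\<close> step
      by (intro exI[of _ "\<lambda>i. p i \<bullet> w"] exI[of _ u]) (simp del: power_Suc)
  qed
  ultimately show ?thesis by blast
qed

section \<open>A direction with projections of dimension one\<close>

lemma iterate_with_linear_part_power: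
  fixes a :: complex
  assumes "\<forall>y\<in>F. a * y + b \<in> F"
  shows "\<exists>t. \<forall>y\<in>F. a ^ k * y + t \<in> F"
proof (induction k)
  case 0
  show ?case by (intro exI[of _ 0]) simp
next
  case (Suc k)
  then obtain t where t: "\<forall>y\<in>F. a ^ k * y + t \<in> F" by blast
  have "a ^ Suc k * y + (a * t + b) \<in> F" if "y \<in> F" for y
  proof -
    have "a * (a ^ k * y + t) + b \<in> F" using assms t that by blast
    then show ?thesis by (simp add: algebra_simps)
  qed
  then show ?case by blast
qed

text \<open>
  If a power \<open>a ^ q\<close> is real and positive, composing each of the three maps with the same word of linear part
  \<open>a ^ (q - 1)\<close> yields three maps with ratio \<open>a ^ q\<close> whose translations are merely shifted by a common
  vector, and so are again not collinear.
\<close>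
lemma rough_progressions_in_some_direction:
  fixes a :: complex
  assumes a: "0 < norm a" "norm a < 1"
    and closed: "\<forall>y\<in>F. \<forall>b\<in>{b0, b1, b2}. a * y + b \<in> F"
    and "F \<noteq> {}" and area: "signed_area b0 b1 b2 \<noteq> 0"
  shows "\<exists>w\<noteq>0. \<exists>B. rough_progressions B ((\<lambda>z. z \<bullet> w) ` F)"
proof (cases "\<forall>q>0. sgn a ^ q \<noteq> 1")
  case True
  have "b0 \<noteq> b1" using area by (auto simp: signed_area_def)
  then have "rough_progressions 2 (Re ` F)"
    using closed \<open>F \<noteq> {}\<close> by (intro rough_progressions_irrational_rotation[OF a True]) auto
  then have "rough_progressions 2 ((\<lambda>z. z \<bullet> 1) ` F)" by (simp add: inner_complex_def)
  then show ?thesis by (metis one_neq_zero)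
next
  case False
  then obtain q where q: "q > 0" "sgn a ^ q = 1" by blast
  define c where "c = norm a ^ q"
  have c: "0 < c" "c < 1" using a q power_Suc_less_one[of "norm a" "q - 1"] by (auto simp: c_def)
  have "a = of_real (norm a) * sgn a" using a by (simp add: sgn_eq)
  then have "a ^ q = of_real c * sgn a ^ q" unfolding c_def by (metis of_real_power power_mult_distrib)
  then have aq: "a * a ^ (q - 1) = of_real c" using q by (simp add: power_eq_if)
  obtain t where t: "\<forall>y\<in>F. a ^ (q - 1) * y + t \<in> F"
    using iterate_with_linear_part_power[of F a b0] closed by blast
  have maps: "of_real c * y + (a * t + b) \<in> F" if "y \<in> F" "b \<in> {b0, b1, b2}" for y b
  proof -
    have "a * (a ^ (q - 1) * y + t) + b \<in> F" using closed t that by blast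
    then show ?thesis unfolding aq[symmetric] by (simp add: algebra_simps)
  qed
  have "\<exists>w\<noteq>0. rough_progressions (1 / (1 - c)) ((\<lambda>z. z \<bullet> w) ` F)"
    using maps \<open>F \<noteq> {}\<close> area
    by (intro rough_progressions_real_ratio[OF c, of F "a * t + b0" "a * t + b1" "a * t + b2"])
       (auto simp: signed_area_translate)
  then show ?thesis by blast
qed

lemma direction_in_half_open_range:
  fixes w :: complex
  assumes "w \<noteq> 0"
  obtains r \<theta> where "r \<noteq> 0" "\<theta> \<in> {0..<pi}" "w = r *\<^sub>R cis \<theta>"
proof -
  define \<phi> where "\<phi> = Arg2pi w"
  have \<phi>: "0 \<le> \<phi>" "\<phi> < 2 * pi" "w = norm w *\<^sub>R cis \<phi>"
    using Arg2pi[of w] by (simp_all add: \<phi>_def is_Arg_def cis_conv_exp scaleR_conv_of_real)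
  show thesis
  proof (cases "\<phi> < pi")
    case True
    then show thesis using that[of "norm w" \<phi>] \<phi> assms by simp
  next
    case False
    have "cis \<phi> = - cis (\<phi> - pi)" by (simp add: complex_eq_iff)
    then have "w = (- norm w) *\<^sub>R cis (\<phi> - pi)" using \<phi>(3) by simp
    then show thesis using that[of "- norm w" "\<phi> - pi"] \<phi> False assms by simp
  qed
qed

theorem theorem2p4:
  fixes F :: "(real^2) set"
  assumes "self_similar_set F"
    and "F \<subseteq> unit_square"
    and "\<not> collinear F"
  shows "\<exists>\<theta>\<in>{0..<pi}. assouad_dim (proj_line \<theta> ` F) = 1"
proof -
  obtain I and S :: "nat \<Rightarrow> real^2 \<Rightarrow> real^2" where IFS: "is_IFS I S" "is_attractor I S F"
    using assms(1) unfolding self_similar_set_def by blast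
  let ?F = "plane_to_complex ` F"
  have "?F \<noteq> {}" using assms(3) by auto
  obtain a b0 b1 b2 where a: "0 < norm a" "norm a < 1" and area: "signed_area b0 b1 b2 \<noteq> 0"
    and "\<And>y b. y \<in> ?F \<Longrightarrow> b \<in> {b0, b1, b2} \<Longrightarrow> a * y + b \<in> ?F"
    using maps_with_common_linear_part[OF IFS assms(3)] by metis
  then have "\<forall>y\<in>?F. \<forall>b\<in>{b0, b1, b2}. a * y + b \<in> ?F" by blast
  then obtain w B where w: "w \<noteq> 0" "rough_progressions B ((\<lambda>z. z \<bullet> w) ` ?F)"
    using rough_progressions_in_some_direction[OF a _ \<open>?F \<noteq> {}\<close> area] by blast
  obtain r \<theta> where r: "r \<noteq> 0" and \<theta>: "\<theta> \<in> {0..<pi}" and w_eq: "w = r *\<^sub>R cis \<theta>"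
    using direction_in_half_open_range[OF w(1)] by metis
  have norm_dir: "norm (unit_dir \<theta>) = 1"
    by (simp add: unit_dir_def norm_vec_def L2_set_def sum_2)
  have inner_dir: "x \<bullet> unit_dir \<theta> = plane_to_complex x \<bullet> cis \<theta>" for x
    by (simp add: unit_dir_def plane_to_complex_def inner_vec_def inner_complex_def sum_2)
  have similar: "dist (proj_line \<theta> x) (proj_line \<theta> y) =
      (1 / \<bar>r\<bar>) * dist (plane_to_complex x \<bullet> w) (plane_to_complex y \<bullet> w)" for x y
  proof -
    have "dist (proj_line \<theta> x) (proj_line \<theta> y) = \<bar>x \<bullet> unit_dir \<theta> - y \<bullet> unit_dir \<theta>\<bar>"
      by (simp add: proj_line_def dist_norm norm_dir flip: scaleR_left_diff_distrib)
    moreover have "dist (plane_to_complex x \<bullet> w) (plane_to_complex y \<bullet> w) =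
        \<bar>r\<bar> * \<bar>x \<bullet> unit_dir \<theta> - y \<bullet> unit_dir \<theta>\<bar>"
      by (simp add: w_eq inner_dir dist_real_def flip: abs_mult right_diff_distrib)
    ultimately show ?thesis using r by simp
  qed
  have "rough_progressions B ((\<lambda>x. plane_to_complex x \<bullet> w) ` F)"
    using w(2) by (simp add: image_image)
  then have "rough_progressions B (proj_line \<theta> ` F)"
    by (rule rough_progressions_similar_image[OF _ _ similar]) (simp add: r)
  then have "assouad_dim (proj_line \<theta> ` F) \<ge> 1" by (rule assouad_dim_ge_1)
  moreover have "assouad_dim (proj_line \<theta> ` F) \<le> 1"
    by (rule assouad_dim_line_le_1[OF norm_dir]) (auto simp: proj_line_def)
  ultimately show ?thesis using \<theta> by (intro bexI[of _ \<theta>] antisym)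
qed

end
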